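(* Let $M$ be a reduced torsion-free monoid (written additively), and let $R$ be a GCD-domain with field of fractions $F$. Then an element $f \in R[M] \setminus R$ is irreducible in $R[M]$ if and only if $f$ is irreducible in $F[M]$ and primitive in $R[M]$.
   Context: A monoid is a commutative and cancellative semigroup with an identity element. It is reduced if its only invertible element is the identity, and torsion-free if (in additive notation) $nx = ny$ with $x,y \in M$ and $n \in \mathbb{N} = \{1,2,\dots\}$ implies $x=y$. For an integral domain $R$ and a reduced torsion-free monoid $M$ written additively, the monoid ring $R[M]$ is the set of all maps $f\colon M \to R$ with finite support, written as polynomial expressions $f = \sum_{s \in M} f(s) X^s$, with addition and multiplication as for polynomials (so $X^s X^t = X^{s+t}$). It is an integral domain with group of units $R^\times$; $R$ is identified with the subring of constants $rX^0$. The ring $R[M]$ is regarded as a subring of $F[M]$. An element $r \in R$ is a greatest common divisor of $r_1,\dots,r_n \in R\setminus\{0\}$ if $r$ divides every $r_i$ in $R$ and $r$ is divisible by each common divisor of $r_1,\dots,r_n$; $\mathrm{GCD}(r_1,\dots,r_n)$ is the set of all greatest common divisors of $r_1,\dots,r_n$. An integral domain $R$ is a GCD-domain if any (nonempty) finite subset of $R\setminus\{0\}$ has a greatest common divisor in $R$. For $f = \alpha_1 X^{q_1} + \dots + \alpha_k X^{q_k} \in R[M]\setminus\{0\}$ with pairwise distinct exponents $q_i$ and nonzero coefficients $\alpha_i$, the content of $f$ is the set $\mathsf{c}(f) := \mathrm{GCD}(\alpha_1,\dots,\alpha_k)$, and $f$ is called primitive if $\mathsf{c}(f) = R^\times$.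 *)

theory Defs
  imports
    "HOL-Library.Poly_Mapping"
    "HOL-Library.Cancellation"
    "HOL-Computational_Algebra.Polynomial_Factorial"
begin

text \<open>
  A (commutative, cancellative) monoid is a type of class \<^class>\<open>cancel_comm_monoid_add\<close>, and the
  monoid ring R[M] is the ring of finitely supported maps from M to R under the convolution
  product of \<^theory>\<open>HOL-Library.Poly_Mapping\<close>.
\<close>

definition reduced_monoid :: "'m::cancel_comm_monoid_add itself \<Rightarrow> bool" where
  "reduced_monoid _ \<longleftrightarrow> (\<forall>x::'m. (\<exists>y. x + y = 0) \<longrightarrow> x = 0)"

definition torsion_free_monoid :: "'m::cancel_comm_monoid_add itself \<Rightarrow> bool" where
  "torsion_free_monoid _ \<longleftrightarrow>
     (\<forall>(x::'m) y n. n \<ge> 1 \<and> iterate_add n x = iterate_add n y \<longrightarrow> x = y)"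

definition GCDs :: "'r::idom set \<Rightarrow> 'r set" where
  "GCDs A = {r. (\<forall>a\<in>A. r dvd a) \<and> (\<forall>d. (\<forall>a\<in>A. d dvd a) \<longrightarrow> d dvd r)}"

text \<open>
  Greatest common divisors are only required to exist; the library class
  \<^class>\<open>semiring_gcd\<close> would in addition fix a choice of them and of normalised associates.
\<close>

definition GCD_domain :: "'r::idom itself \<Rightarrow> bool" where
  "GCD_domain _ \<longleftrightarrow> (\<forall>A::'r set. finite A \<and> A \<noteq> {} \<and> 0 \<notin> A \<longrightarrow> GCDs A \<noteq> {})"

definition constants :: "('m::zero \<Rightarrow>\<^sub>0 'r::zero) set" where
  "constants = range (Poly_Mapping.single 0)"

text \<open>Content and primitivity are only meaningful for nonzero arguments.\<close>

definition content_set :: "('m \<Rightarrow>\<^sub>0 'r::idom) \<Rightarrow> 'r set" where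
  "content_set f = GCDs (Poly_Mapping.lookup f ` Poly_Mapping.keys f)"

definition primitive :: "('m \<Rightarrow>\<^sub>0 'r::idom) \<Rightarrow> bool" where
  "primitive f \<longleftrightarrow> content_set f = {r. r dvd 1}"

definition to_fract_ring :: "('m \<Rightarrow>\<^sub>0 'r::idom) \<Rightarrow> ('m \<Rightarrow>\<^sub>0 'r fract)" where
  "to_fract_ring = Poly_Mapping.map to_fract"

end

theory Submission
  imports Defs
begin

text \<open>
  This is Gauss' lemma and its classical consequence for polynomials, with exponents in \<open>M\<close>
  instead of the natural numbers. Two facts replace what degrees do for polynomials.

  By Levi's theorem, a torsion-free cancellative monoid carries a translation-invariant
  linear order (\<open>torsion_free_monoid_orderable\<close>). Hence the greatest exponents \<open>s\<close>, \<open>t\<close> of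
  two nonzero elements determine a leading term of their product: \<open>s + t\<close> arises from no
  other pair of exponents. Using this for an order and for its converse, one sees that if \<open>f\<close> is
  a unit and \<open>M\<close> is reduced, then 0 is both the greatest and the least exponent of \<open>f\<close>. So
  units are constants, over \<open>R\<close> and over \<open>F\<close> (\<open>unit_in_constants\<close>).

  Over a GCD-domain, which may have no prime elements, the lemma of Gauss (\<open>gauss_lemma\<close>) is
  proved by induction on the number of terms. Let \<open>d\<close> divide \<open>f * g\<close> with \<open>f\<close>, \<open>g\<close>
  primitive and with leading coefficients \<open>a\<close>, \<open>b\<close>. A common divisor of \<open>d\<close> and \<open>a\<close> divides
  the product of \<open>g\<close> with \<open>f\<close> stripped of its leading term; by induction it divides the
  stripped \<open>f\<close>, hence \<open>f\<close>, and so it is a unit. The same holds for \<open>d\<close> and \<open>b\<close>. As \<open>d\<close>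
  divides \<open>a * b\<close>, it is a unit.

  Now let \<open>f\<close> be irreducible over \<open>R\<close> and not constant. Splitting off the content shows that
  \<open>f\<close> is primitive. A factorisation over \<open>F\<close> becomes, after clearing denominators and
  extracting contents, an equation \<open>p f = q g h\<close> with constants \<open>p\<close>, \<open>q\<close> and primitive \<open>g\<close>,
  \<open>h\<close>; as \<open>g h\<close> is primitive, \<open>p\<close> divides \<open>q\<close>, and this is a factorisation of \<open>f\<close> over
  \<open>R\<close>. Conversely, a factor over \<open>R\<close> of a primitive \<open>f\<close> that becomes a unit over \<open>F\<close> is a
  constant dividing all coefficients of \<open>f\<close>, hence a unit of \<open>R\<close>.
\<close>

section \<open>Translation-invariant linear orders on torsion-free monoids\<close>

lemma iterate_add_plus: "iterate_add n (x + y) = iterate_add n x + iterate_add n y"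
  by (induction n) (simp_all add: ac_simps)

lemma iterate_add_mult: "iterate_add (m * n) x = iterate_add m (iterate_add n x)"
  by (induction m) simp_all

text \<open>
  The linear order is a maximal element among the invariant partial orders by Zorn's lemma.
  Closure under taking roots is required of them in addition: it makes an order extendable
  at every incomparable pair, and it holds for the equality relation exactly when the monoid is
  torsion-free. Invariance is an equivalence since the order is to come from one on the group of
  differences.
\<close>

definition root_closed_order :: "('m::cancel_comm_monoid_add \<times> 'm) set \<Rightarrow> bool" where
  "root_closed_order r \<longleftrightarrow> refl r \<and> trans r \<and> antisym r \<and>
     (\<forall>x y z. (x + z, y + z) \<in> r \<longleftrightarrow> (x, y) \<in> r) \<and>
     (\<forall>x y n. n \<ge> 1 \<and> (iterate_add n x, iterate_add n y) \<in> r \<longrightarrow> (x, y) \<in> r)"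

lemma
  assumes "root_closed_order r"
  shows root_closed_order_refl: "(x, x) \<in> r"
    and root_closed_order_trans: "(x, y) \<in> r \<Longrightarrow> (y, z) \<in> r \<Longrightarrow> (x, z) \<in> r"
    and root_closed_order_antisym: "(x, y) \<in> r \<Longrightarrow> (y, x) \<in> r \<Longrightarrow> x = y"
    and root_closed_order_shift: "(x + z, y + z) \<in> r \<longleftrightarrow> (x, y) \<in> r"
    and root_closed_order_root: "n \<ge> 1 \<Longrightarrow> (iterate_add n x, iterate_add n y) \<in> r \<Longrightarrow> (x, y) \<in> r"
  using assms unfolding root_closed_order_def
  by (blast dest: refl_onD transD antisymD)+

lemma root_closed_order_add:
  assumes "root_closed_order r" "(x, y) \<in> r" "(x', y') \<in> r"
  shows "(x + x', y + y') \<in> r"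
  using assms root_closed_order_trans root_closed_order_shift
  by (metis add.commute)

lemma root_closed_order_iterate_add:
  assumes "root_closed_order r" "(x, y) \<in> r"
  shows "(iterate_add n x, iterate_add n y) \<in> r"
  by (induction n) (simp_all add: assms root_closed_order_refl root_closed_order_add)

text \<open>
  Think of an order as the set of elements \<open>y - x \<ge> 0\<close> in the group of differences. Adding
  \<open>b - a\<close> and closing under sums and roots gives the order in which \<open>x \<le> y\<close> means
  \<open>m (y - x) \<ge> n (b - a)\<close> for some \<open>m \<ge> 1\<close> and \<open>n \<ge> 0\<close>; the relation \<open>r'\<close> below
  states this without subtraction. It is antisymmetric because a cycle that uses \<open>b - a\<close> would give
  \<open>k b \<le> k a\<close> for some \<open>k \<ge> 1\<close> in the old order, so \<open>b \<le> a\<close> by taking roots.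
\<close>

lemma root_closed_order_extend:
  fixes r :: "('m::cancel_comm_monoid_add \<times> 'm) set"
  assumes r: "root_closed_order r" and ba: "(b, a) \<notin> r"
  obtains r' where "root_closed_order r'" "r \<subseteq> r'" "(a, b) \<in> r'"
proof -
  define r' where "r' = {(x, y). \<exists>m n. m \<ge> 1 \<and>
      (iterate_add m x + iterate_add n b, iterate_add m y + iterate_add n a) \<in> r}"
  have sub: "r \<subseteq> r'"
  proof clarify
    fix x y assume "(x, y) \<in> r"
    hence "(iterate_add 1 x + iterate_add 0 b, iterate_add 1 y + iterate_add 0 a) \<in> r"
      by simp
    thus "(x, y) \<in> r'" unfolding r'_def by blast
  qed
  have "(iterate_add 1 a + iterate_add 1 b, iterate_add 1 b + iterate_add 1 a) \<in> r"
    by (simp add: add.commute root_closed_order_refl[OF r])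
  hence ab: "(a, b) \<in> r'" unfolding r'_def by blast
  \<comment> \<open>Scale the two inequalities by \<open>m'\<close> and \<open>m\<close>, so that \<open>y\<close> cancels in their sum.\<close>
  have compose: "(iterate_add (m * m') x + iterate_add (m' * n + m * n') b,
         iterate_add (m * m') z + iterate_add (m' * n + m * n') a) \<in> r"
    if 1: "(iterate_add m x + iterate_add n b, iterate_add m y + iterate_add n a) \<in> r"
      and 2: "(iterate_add m' y + iterate_add n' b, iterate_add m' z + iterate_add n' a) \<in> r"
    for m n m' n' x y z
  proof -
    have "(iterate_add m' (iterate_add m x + iterate_add n b)
             + iterate_add m (iterate_add m' y + iterate_add n' b),
           iterate_add m' (iterate_add m y + iterate_add n a)
             + iterate_add m (iterate_add m' z + iterate_add n' a)) \<in> r"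
      using root_closed_order_add[OF r root_closed_order_iterate_add[OF r 1]
          root_closed_order_iterate_add[OF r 2]] .
    hence "(iterate_add (m * m') x + iterate_add (m' * n + m * n') b + iterate_add (m * m') y,
         iterate_add (m * m') z + iterate_add (m' * n + m * n') a + iterate_add (m * m') y) \<in> r"
      by (simp add: iterate_add_plus iterate_add_mult[symmetric] ac_simps)
    thus ?thesis unfolding root_closed_order_shift[OF r] .
  qed
  have "root_closed_order r'"
    unfolding root_closed_order_def
  proof (intro conjI allI impI)
    show "refl r'" using sub root_closed_order_refl[OF r] by (auto intro: refl_onI)
    show "trans r'"
    proof (rule transI)
      fix x y z assume "(x, y) \<in> r'" "(y, z) \<in> r'"
      then obtain m n m' n' where "m \<ge> 1" "m' \<ge> 1"
        "(iterate_add m x + iterate_add n b, iterate_add m y + iterate_add n a) \<in> r"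
        "(iterate_add m' y + iterate_add n' b, iterate_add m' z + iterate_add n' a) \<in> r"
        unfolding r'_def by blast
      moreover from this have "m * m' \<ge> 1" by simp
      ultimately show "(x, z) \<in> r'" using compose unfolding r'_def by blast
    qed
    show "antisym r'"
    proof (rule antisymI)
      fix x y assume "(x, y) \<in> r'" "(y, x) \<in> r'"
      then obtain m n m' n' where m: "m \<ge> 1" "m' \<ge> 1" and
        1: "(iterate_add m x + iterate_add n b, iterate_add m y + iterate_add n a) \<in> r" and
        2: "(iterate_add m' y + iterate_add n' b, iterate_add m' x + iterate_add n' a) \<in> r"
        unfolding r'_def by blast
      have "(iterate_add (m' * n + m * n') b, iterate_add (m' * n + m * n') a) \<in> r"
        using compose[OF 1 2] root_closed_order_shift[OF r] by (metis add.commute)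
      hence "\<not> m' * n + m * n' \<ge> 1"
        using ba root_closed_order_root[OF r] by blast
      hence "m' * n + m * n' = 0" by linarith
      hence "n = 0" "n' = 0" using m by auto
      hence "(iterate_add m x, iterate_add m y) \<in> r" "(iterate_add m' y, iterate_add m' x) \<in> r"
        using 1 2 by simp_all
      hence "(x, y) \<in> r" "(y, x) \<in> r"
        using m root_closed_order_root[OF r] by blast+
      thus "x = y" by (rule root_closed_order_antisym[OF r])
    qed
  next
    fix x y z :: 'm
    have "(iterate_add m (x + z) + iterate_add n b, iterate_add m (y + z) + iterate_add n a) \<in> r
        \<longleftrightarrow> (iterate_add m x + iterate_add n b, iterate_add m y + iterate_add n a) \<in> r" for m n
      using root_closed_order_shift[OF r, of "iterate_add m x + iterate_add n b" "iterate_add m z"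
          "iterate_add m y + iterate_add n a"]
      by (simp add: iterate_add_plus ac_simps)
    thus "(x + z, y + z) \<in> r' \<longleftrightarrow> (x, y) \<in> r'" unfolding r'_def by simp
  next
    fix x y :: 'm and k
    assume k: "1 \<le> k \<and> (iterate_add k x, iterate_add k y) \<in> r'"
    then obtain m n where "m \<ge> 1"
      "(iterate_add (m * k) x + iterate_add n b, iterate_add (m * k) y + iterate_add n a) \<in> r"
      unfolding r'_def iterate_add_mult by blast
    moreover have "m * k \<ge> 1" using k \<open>m \<ge> 1\<close> by simp
    ultimately show "(x, y) \<in> r'" unfolding r'_def by blast
  qed
  thus thesis using that sub ab by blast
qed

lemma root_closed_order_Union_chain:
  assumes "C \<noteq> {}" and chain: "subset.chain {r. root_closed_order r} C"
  shows "root_closed_order (\<Union>C)"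
proof -
  have C: "root_closed_order r" if "r \<in> C" for r
    using chain that unfolding subset.chain_def by auto
  have common: "\<exists>r\<in>C. p \<in> r \<and> q \<in> r" if pq: "p \<in> \<Union>C" "q \<in> \<Union>C" for p q
  proof -
    obtain r s where rs: "r \<in> C" "p \<in> r" "s \<in> C" "q \<in> s" using pq by blast
    hence "r \<subseteq> s \<or> s \<subseteq> r" using chain unfolding subset_chain_def by blast
    thus ?thesis using rs by blast
  qed
  show ?thesis
    unfolding root_closed_order_def
  proof (intro conjI allI impI)
    show "refl (\<Union>C)" using \<open>C \<noteq> {}\<close> root_closed_order_refl[OF C] by (auto intro!: refl_onI)
    show "trans (\<Union>C)"
    proof (rule transI)
      fix x y z assume "(x, y) \<in> \<Union>C" "(y, z) \<in> \<Union>C"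
      then obtain r where "r \<in> C" "(x, y) \<in> r" "(y, z) \<in> r" using common by blast
      thus "(x, z) \<in> \<Union>C" using root_closed_order_trans[OF C] by blast
    qed
    show "antisym (\<Union>C)"
    proof (rule antisymI)
      fix x y assume "(x, y) \<in> \<Union>C" "(y, x) \<in> \<Union>C"
      then obtain r where "r \<in> C" "(x, y) \<in> r" "(y, x) \<in> r" using common by blast
      thus "x = y" using root_closed_order_antisym[OF C] by blast
    qed
  next
    fix x y z show "(x + z, y + z) \<in> \<Union>C \<longleftrightarrow> (x, y) \<in> \<Union>C"
      using root_closed_order_shift[OF C] by auto
  next
    fix x y n assume "1 \<le> n \<and> (iterate_add n x, iterate_add n y) \<in> \<Union>C"
    then obtain r where "r \<in> C" "(iterate_add n x, iterate_add n y) \<in> r" "n \<ge> 1" by blast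
    thus "(x, y) \<in> \<Union>C" using root_closed_order_root[OF C] by blast
  qed
qed

definition invariant_linear_order :: "('m::cancel_comm_monoid_add \<times> 'm) set \<Rightarrow> bool" where
  "invariant_linear_order r \<longleftrightarrow> linear_order r \<and> (\<forall>x y z. (x, y) \<in> r \<longrightarrow> (x + z, y + z) \<in> r)"

lemma invariant_linear_order_converse:
  "invariant_linear_order r \<Longrightarrow> invariant_linear_order (r\<inverse>)"
  by (simp add: invariant_linear_order_def)

text \<open>
  Levi's theorem, for monoids: a maximal root-closed order leaves no pair incomparable.
\<close>

theorem torsion_free_monoid_orderable:
  assumes "torsion_free_monoid TYPE('m::cancel_comm_monoid_add)"
  obtains r :: "('m::cancel_comm_monoid_add \<times> 'm) set" where "invariant_linear_order r"
proof -
  have "root_closed_order (Id :: ('m \<times> 'm) set)"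
    using assms unfolding root_closed_order_def torsion_free_monoid_def
    by (auto intro: refl_Id trans_Id antisym_Id)
  hence "\<exists>r\<in>{r :: ('m \<times> 'm) set. root_closed_order r}.
           \<forall>s\<in>{r. root_closed_order r}. r \<subseteq> s \<longrightarrow> s = r"
    by (intro subset_Zorn_nonempty) (auto intro: root_closed_order_Union_chain)
  then obtain r :: "('m \<times> 'm) set" where r: "root_closed_order r"
    and max: "\<And>s. root_closed_order s \<Longrightarrow> r \<subseteq> s \<Longrightarrow> s = r" by blast
  have "total r"
    using root_closed_order_extend[OF r] max unfolding total_on_def by metis
  moreover have "refl r" "trans r" "antisym r"
    using r unfolding root_closed_order_def by blast+
  ultimately have "linear_order r"
    by (simp add: linear_order_on_def partial_order_on_def preorder_on_def)
  moreover have "(x, y) \<in> r \<Longrightarrow> (x + z, y + z) \<in> r" for x y z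
    using root_closed_order_shift[OF r] by simp
  ultimately have "invariant_linear_order r" unfolding invariant_linear_order_def by blast
  thus thesis by (rule that)
qed

section \<open>Leading terms and units in monoid rings\<close>

lemma linear_order_greatest:
  assumes "linear_order r" "finite A" "A \<noteq> {}"
  obtains s where "s \<in> A" "\<And>a. a \<in> A \<Longrightarrow> (a, s) \<in> r"
proof -
  have r: "refl r" "trans r" "total r"
    using assms(1) by (simp_all add: linear_order_on_def partial_order_on_def preorder_on_def)
  have refl: "(x, x) \<in> r" for x using r(1) by (simp add: refl_onD)
  have total: "(x, y) \<in> r \<or> (y, x) \<in> r" for x y
    using r(3) refl by (cases "x = y") (auto simp: total_on_def)
  from assms(2,3) have "\<exists>s\<in>A. \<forall>a\<in>A. (a, s) \<in> r"
  proof (induction A rule: finite_ne_induct)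
    case (singleton x)
    thus ?case using refl by simp
  next
    case (insert x A)
    then obtain s where s: "s \<in> A" "\<forall>a\<in>A. (a, s) \<in> r" by blast
    show ?case
    proof (cases "(x, s) \<in> r")
      case True
      thus ?thesis using s by blast
    next
      case False
      hence "(s, x) \<in> r" using total by blast
      hence "\<forall>a\<in>insert x A. (a, x) \<in> r" using s(2) refl transD[OF r(2)] by blast
      thus ?thesis by blast
    qed
  qed
  thus thesis using that by blast
qed

text \<open>
  Only one pair of exponents contributes to the coefficient at \<open>s + t\<close>.
\<close>

lemma lookup_mult_unique_sum:
  fixes f g :: "'m::cancel_comm_monoid_add \<Rightarrow>\<^sub>0 'a::semiring_0"
  assumes "\<And>a b. a \<in> Poly_Mapping.keys f \<Longrightarrow> b \<in> Poly_Mapping.keys g \<Longrightarrow> a + b = s + t \<Longrightarrow> a = s"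
  shows "Poly_Mapping.lookup (f * g) (s + t) = Poly_Mapping.lookup f s * Poly_Mapping.lookup g t"
proof -
  have *: "Poly_Mapping.lookup f l * (\<Sum>q. Poly_Mapping.lookup g q when s + t = l + q)
      = (Poly_Mapping.lookup f l * Poly_Mapping.lookup g t when l = s)" for l
  proof (cases "l = s \<or> l \<notin> Poly_Mapping.keys f")
    case True
    thus ?thesis by (auto simp: in_keys_iff)
  next
    case False
    hence "(Poly_Mapping.lookup g q when s + t = l + q) = 0" for q
      using assms[of l q] by (cases "q \<in> Poly_Mapping.keys g") (auto simp: in_keys_iff when_def)
    thus ?thesis using False by simp
  qed
  show ?thesis unfolding lookup_mult * by simp
qed

text \<open>
  If \<open>a + b = s + t\<close> with \<open>a \<le> s\<close> and \<open>b \<le> t\<close>, then \<open>a + b \<le> s + b \<le> s + t\<close> is a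
  chain of equalities, and \<open>a = s\<close> by cancellation.
\<close>

lemma leading_coeff_mult:
  fixes f g :: "'m::cancel_comm_monoid_add \<Rightarrow>\<^sub>0 'a::semiring_0"
  assumes r: "invariant_linear_order r" and "f \<noteq> 0" "g \<noteq> 0"
  obtains s t where "s \<in> Poly_Mapping.keys f" "t \<in> Poly_Mapping.keys g"
    "\<And>a. a \<in> Poly_Mapping.keys f \<Longrightarrow> (a, s) \<in> r"
    "Poly_Mapping.lookup (f * g) (s + t) = Poly_Mapping.lookup f s * Poly_Mapping.lookup g t"
proof -
  have lin: "linear_order r" and inv: "\<And>x y z. (x, y) \<in> r \<Longrightarrow> (x + z, y + z) \<in> r"
    using r unfolding invariant_linear_order_def by simp_all
  have anti: "antisym r" using lin by (simp add: linear_order_on_def partial_order_on_def)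
  obtain s where s: "s \<in> Poly_Mapping.keys f" "\<And>a. a \<in> Poly_Mapping.keys f \<Longrightarrow> (a, s) \<in> r"
    using linear_order_greatest[OF lin, of "Poly_Mapping.keys f"] assms(2) by auto
  obtain t where t: "t \<in> Poly_Mapping.keys g" "\<And>b. b \<in> Poly_Mapping.keys g \<Longrightarrow> (b, t) \<in> r"
    using linear_order_greatest[OF lin, of "Poly_Mapping.keys g"] assms(3) by auto
  have uniq: "a = s" if ab: "a \<in> Poly_Mapping.keys f" "b \<in> Poly_Mapping.keys g" "a + b = s + t" for a b
  proof -
    have "(a + b, s + b) \<in> r" by (rule inv[OF s(2)[OF ab(1)]])
    moreover have "(b + s, t + s) \<in> r" by (rule inv[OF t(2)[OF ab(2)]])
    hence "(s + b, a + b) \<in> r" unfolding ab(3) by (simp add: add.commute)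
    ultimately have "a + b = s + b"
      by (rule antisymD[OF anti])
    thus ?thesis by simp
  qed
  show thesis
    by (rule that[OF s(1) t(1) s(2)], assumption, rule lookup_mult_unique_sum, rule uniq)
qed

lemma constants_iff_keys: "f \<in> constants \<longleftrightarrow> Poly_Mapping.keys f \<subseteq> {0}"
proof
  assume "Poly_Mapping.keys f \<subseteq> {0}"
  hence "f = Poly_Mapping.single 0 (Poly_Mapping.lookup f 0)"
    by (intro poly_mapping_eqI) (auto simp: lookup_single when_def in_keys_iff)
  thus "f \<in> constants" unfolding constants_def by blast
qed (auto simp: constants_def split: if_splits)

text \<open>
  For \<open>f * g = 1\<close> the leading exponents satisfy \<open>s + t = 0\<close>, so \<open>s = 0\<close> in a reduced
  monoid. Thus no exponent of \<open>f\<close> exceeds 0; the converse order shows that none is below 0.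
\<close>

theorem unit_in_constants:
  fixes f :: "'m::cancel_comm_monoid_add \<Rightarrow>\<^sub>0 'a::idom"
  assumes red: "reduced_monoid TYPE('m)" and tf: "torsion_free_monoid TYPE('m)"
    and unit: "f dvd 1"
  shows "f \<in> constants"
proof -
  obtain r :: "('m \<times> 'm) set" where r: "invariant_linear_order r"
    using torsion_free_monoid_orderable[OF tf] .
  obtain g where fg: "f * g = 1" using unit by (metis dvdE)
  hence nz: "f \<noteq> 0" "g \<noteq> 0" by auto
  have top: "(a, 0) \<in> q" if q: "invariant_linear_order q" and a: "a \<in> Poly_Mapping.keys f" for q a
  proof -
    obtain s t where st: "s \<in> Poly_Mapping.keys f" "t \<in> Poly_Mapping.keys g"
      "\<And>a. a \<in> Poly_Mapping.keys f \<Longrightarrow> (a, s) \<in> q"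
      "Poly_Mapping.lookup (f * g) (s + t) = Poly_Mapping.lookup f s * Poly_Mapping.lookup g t"
      using leading_coeff_mult[OF q nz] by blast
    hence "Poly_Mapping.lookup 1 (s + t) \<noteq> (0 :: 'a)" by (simp add: fg in_keys_iff)
    hence "s + t = 0" by (simp add: lookup_one)
    hence "s = 0" using red unfolding reduced_monoid_def by blast
    thus ?thesis using st(3) a by blast
  qed
  have "antisym r"
    using r by (simp add: invariant_linear_order_def linear_order_on_def partial_order_on_def)
  hence "a = 0" if "a \<in> Poly_Mapping.keys f" for a
    using top[OF r that] top[OF invariant_linear_order_converse[OF r] that]
    by (simp add: antisymD)
  thus ?thesis unfolding constants_iff_keys by blast
qed

section \<open>Constants and divisibility of coefficients\<close>

abbreviation const :: "'a \<Rightarrow> 'm::zero \<Rightarrow>\<^sub>0 'a::zero" where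
  "const \<equiv> Poly_Mapping.single 0"

lemma const_mult: "const (a * b) = (const a * const b :: 'm::monoid_add \<Rightarrow>\<^sub>0 'a::semiring_0)"
  by (simp add: mult_single)

lemma lookup_const_mult:
  fixes f :: "'m::cancel_comm_monoid_add \<Rightarrow>\<^sub>0 'a::semiring_0"
  shows "Poly_Mapping.lookup (const c * f) k = c * Poly_Mapping.lookup f k"
proof -
  have "a = 0" if "a \<in> Poly_Mapping.keys (const c :: 'm \<Rightarrow>\<^sub>0 'a)" for a
    using that by (simp split: if_splits)
  from lookup_mult_unique_sum[of "const c" f 0 k, OF this] show ?thesis by simp
qed

lemma poly_mapping_sum_singles:
  "f = (\<Sum>k\<in>Poly_Mapping.keys f. Poly_Mapping.single k (Poly_Mapping.lookup f k))"
  by (rule poly_mapping_eqI) (auto simp: lookup_sum lookup_single when_def in_keys_iff)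

text \<open>
  This turns common divisors of coefficients into divisors in the monoid ring, where they can be
  handled by ring identities.
\<close>

lemma const_dvd_iff:
  fixes f :: "'m::cancel_comm_monoid_add \<Rightarrow>\<^sub>0 'a::comm_ring_1"
  shows "const d dvd f \<longleftrightarrow> (\<forall>k\<in>Poly_Mapping.keys f. d dvd Poly_Mapping.lookup f k)"
proof
  assume "const d dvd f"
  thus "\<forall>k\<in>Poly_Mapping.keys f. d dvd Poly_Mapping.lookup f k"
    by (metis dvd_def lookup_const_mult)
next
  assume *: "\<forall>k\<in>Poly_Mapping.keys f. d dvd Poly_Mapping.lookup f k"
  have "const d dvd Poly_Mapping.single k c" if "d dvd c" for k :: 'm and c
    using that by (metis add_0 dvd_def mult_single)
  thus "const d dvd f"
    by (subst poly_mapping_sum_singles) (auto intro!: dvd_sum simp: *)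
qed

lemma const_dvd_const_iff:
  "(const d :: 'm::cancel_comm_monoid_add \<Rightarrow>\<^sub>0 'a::comm_ring_1) dvd const c \<longleftrightarrow> d dvd c"
  by (simp add: const_dvd_iff)

lemma const_dvd_one_iff:
  "(const c :: 'm::cancel_comm_monoid_add \<Rightarrow>\<^sub>0 'a::comm_ring_1) dvd 1 \<longleftrightarrow> c dvd 1"
  using const_dvd_const_iff[of c 1] by simp

lemma const_mult_cancel:
  fixes f g :: "'m::cancel_comm_monoid_add \<Rightarrow>\<^sub>0 'a::idom"
  assumes "c \<noteq> 0"
  shows "const c * f = const c * g \<longleftrightarrow> f = g"
  using assms by (auto intro!: poly_mapping_eqI simp: poly_mapping_eq_iff fun_eq_iff lookup_const_mult)

lemma keys_const_mult:
  fixes f :: "'m::cancel_comm_monoid_add \<Rightarrow>\<^sub>0 'a::idom"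
  assumes "c \<noteq> 0"
  shows "Poly_Mapping.keys (const c * f) = Poly_Mapping.keys f"
  using assms by (auto simp: in_keys_iff lookup_const_mult)

section \<open>Greatest common divisors and primitive elements\<close>

text \<open>
  The element 0 can be dropped from a set without changing its greatest common divisors; for
  a set without nonzero elements, 0 itself is one.
\<close>

lemma GCDs_nonempty:
  fixes A :: "'r::idom set"
  assumes "GCD_domain TYPE('r)" "finite A"
  shows "GCDs A \<noteq> {}"
proof (cases "A \<subseteq> {0}")
  case True
  hence "0 \<in> GCDs A" by (auto simp: GCDs_def)
  thus ?thesis by blast
next
  case False
  have "GCDs A = GCDs (A - {0})" by (auto simp: GCDs_def)
  thus ?thesis using assms False unfolding GCD_domain_def by auto
qed

text \<open>
  Let \<open>h\<close> be a greatest common divisor of \<open>c A\<close>. It is a multiple \<open>c k\<close> of \<open>c\<close>,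
  and \<open>k\<close> divides every element of \<open>A\<close>, hence divides \<open>g\<close>; so \<open>h\<close> divides \<open>c g\<close>. The
  existence of \<open>h\<close> is essential: in a general domain the scaled set may have no greatest
  common divisor.
\<close>

lemma GCDs_mult_left:
  fixes A :: "'r::idom set"
  assumes "GCD_domain TYPE('r)" "finite A" "g \<in> GCDs A"
  shows "c * g \<in> GCDs ((*) c ` A)"
proof (cases "c = 0")
  case True
  thus ?thesis by (auto simp: GCDs_def)
next
  case False
  obtain h where h: "h \<in> GCDs ((*) c ` A)"
    using GCDs_nonempty[OF assms(1), of "(*) c ` A"] assms(2) by blast
  hence "c dvd h" by (auto simp: GCDs_def)
  then obtain k where k: "h = c * k" by blast
  hence "\<forall>a\<in>A. k dvd a" using h False by (auto simp: GCDs_def)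
  hence "h dvd c * g" using assms(3) k False by (auto simp: GCDs_def)
  thus ?thesis using h assms(3) by (auto simp: GCDs_def intro: dvd_trans)
qed

text \<open>
  Since 1 is a greatest common divisor of \<open>c\<close> and \<open>a\<close>, scaling makes \<open>b\<close> one of \<open>b c\<close> and \<open>b a\<close>.
\<close>

lemma GCD_domain_coprime_dvd_mult:
  fixes a b c :: "'r::idom"
  assumes "GCD_domain TYPE('r)" and "\<And>e. e dvd c \<Longrightarrow> e dvd a \<Longrightarrow> e dvd 1" and "c dvd a * b"
  shows "c dvd b"
proof -
  have "1 \<in> GCDs {c, a}" using assms(2) by (auto simp: GCDs_def)
  hence "b * 1 \<in> GCDs ((*) b ` {c, a})" by (intro GCDs_mult_left assms) auto
  thus ?thesis using assms(3) by (auto simp: GCDs_def mult.commute)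
qed

lemma content_set_iff:
  fixes f :: "'m::cancel_comm_monoid_add \<Rightarrow>\<^sub>0 'r::idom"
  shows "c \<in> content_set f \<longleftrightarrow> const c dvd f \<and> (\<forall>d. const d dvd f \<longrightarrow> d dvd c)"
  by (simp add: content_set_def GCDs_def const_dvd_iff)

lemma primitive_iff:
  fixes f :: "'m::cancel_comm_monoid_add \<Rightarrow>\<^sub>0 'r::idom"
  shows "primitive f \<longleftrightarrow> (\<forall>d. const d dvd f \<longrightarrow> d dvd 1)"
proof
  assume "primitive f"
  hence "1 \<in> content_set f" by (simp add: primitive_def)
  thus "\<forall>d. const d dvd f \<longrightarrow> d dvd 1" by (simp add: content_set_iff)
next
  assume *: "\<forall>d. const d dvd f \<longrightarrow> d dvd 1"
  have "c \<in> content_set f \<longleftrightarrow> c dvd 1" for c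
    using * const_dvd_one_iff unfolding content_set_iff by (meson dvd_trans one_dvd)
  thus "primitive f" unfolding primitive_def by blast
qed

text \<open>
  The content of \<open>c g\<close> is \<open>c\<close> times the content of \<open>g\<close>.
\<close>

lemma primitive_const_dvd_const_mult:
  fixes g :: "'m::cancel_comm_monoid_add \<Rightarrow>\<^sub>0 'r::idom"
  assumes "GCD_domain TYPE('r)" "primitive g" "const d dvd const c * g"
  shows "d dvd c"
proof -
  let ?A = "Poly_Mapping.lookup g ` Poly_Mapping.keys g"
  have "1 \<in> GCDs ?A" using assms(2) unfolding primitive_def content_set_def by auto
  hence "c * 1 \<in> GCDs ((*) c ` ?A)" by (intro GCDs_mult_left assms) auto
  moreover have "d dvd c * Poly_Mapping.lookup g k" for k
    using assms(3) by (metis dvd_def lookup_const_mult)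
  ultimately show ?thesis by (auto simp: GCDs_def)
qed

lemma primitive_part:
  fixes f :: "'m::cancel_comm_monoid_add \<Rightarrow>\<^sub>0 'r::idom"
  assumes "GCD_domain TYPE('r)" "f \<noteq> 0"
  obtains c g where "f = const c * g" "c \<noteq> 0" "primitive g"
proof -
  obtain c where c: "c \<in> content_set f"
    using GCDs_nonempty[OF assms(1), of "Poly_Mapping.lookup f ` Poly_Mapping.keys f"]
    unfolding content_set_def by auto
  then obtain g where g: "f = const c * g" unfolding content_set_iff by blast
  hence "c \<noteq> 0" using assms(2) by auto
  have "d dvd 1" if "const d dvd g" for d
  proof -
    have "const (c * d) dvd f" unfolding g const_mult using that by (rule mult_dvd_mono[OF dvd_refl])
    hence "c * d dvd c * 1" using c unfolding content_set_iff by simp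
    thus ?thesis using \<open>c \<noteq> 0\<close> unfolding dvd_mult_cancel_left by simp
  qed
  hence "primitive g" unfolding primitive_iff by blast
  thus thesis by (rule that[OF g \<open>c \<noteq> 0\<close>])
qed

section \<open>The lemma of Gauss\<close>

text \<open>
  The inductive step in the lemma of Gauss. Let \<open>m\<close> be the term of \<open>f\<close> at \<open>s\<close>. Then \<open>e\<close>
  divides \<open>m\<close>, hence \<open>(f - m) g\<close>. If \<open>f - m\<close> is not 0, its primitive part \<open>h\<close> has fewer terms
  than \<open>f\<close>, so \<open>h g\<close> is primitive and \<open>e\<close> divides the content of \<open>f - m\<close>. Therefore \<open>e\<close>
  divides \<open>(f - m) + m = f\<close>, which is primitive.
\<close>

lemma common_divisor_with_coeff_unit:
  fixes f g :: "'m::cancel_comm_monoid_add \<Rightarrow>\<^sub>0 'r::idom"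
  assumes gcd: "GCD_domain TYPE('r)"
    and IH: "\<And>h. card (Poly_Mapping.keys h) < card (Poly_Mapping.keys f) \<Longrightarrow> primitive h \<Longrightarrow> primitive (h * g)"
    and prim: "primitive f" and s: "s \<in> Poly_Mapping.keys f"
    and e: "const e dvd f * g" "e dvd Poly_Mapping.lookup f s"
  shows "e dvd 1"
proof -
  define m where "m = Poly_Mapping.single s (Poly_Mapping.lookup f s)"
  have m: "const e dvd m" using e(2) by (simp add: m_def const_dvd_iff)
  have keys: "Poly_Mapping.keys (f - m) = Poly_Mapping.keys f - {s}"
    by (auto simp: in_keys_iff lookup_minus m_def lookup_single when_def split: if_splits)
  have "const e dvd f - m"
  proof (cases "f - m = 0")
    case False
    then obtain c h where h: "f - m = const c * h" "c \<noteq> 0" "primitive h"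
      using primitive_part[OF gcd] by blast
    have "Poly_Mapping.keys h = Poly_Mapping.keys f - {s}" using keys keys_const_mult h by metis
    hence "card (Poly_Mapping.keys h) < card (Poly_Mapping.keys f)"
      using s by (metis card_Diff1_less finite_keys)
    hence "primitive (h * g)" using IH h by blast
    moreover have "const e dvd (f - m) * g"
      unfolding left_diff_distrib using e(1) m by (simp add: dvd_diff)
    hence "const e dvd const c * (h * g)" by (simp add: h mult.assoc)
    ultimately have "e dvd c" using primitive_const_dvd_const_mult[OF gcd] by blast
    hence "(const e :: 'm \<Rightarrow>\<^sub>0 'r) dvd const c" by (simp add: const_dvd_const_iff)
    thus ?thesis unfolding h by simp
  qed simp
  hence "const e dvd (f - m) + m" using m by (rule dvd_add)
  thus ?thesis using prim by (simp add: primitive_iff)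
qed

text \<open>
  The product of the leading coefficients is a coefficient of \<open>f * g\<close>, so a common divisor \<open>d\<close>
  of the coefficients of \<open>f * g\<close> divides it; but \<open>d\<close> is coprime to both of its factors.
\<close>

theorem gauss_lemma:
  fixes f g :: "'m::cancel_comm_monoid_add \<Rightarrow>\<^sub>0 'r::idom"
  assumes tf: "torsion_free_monoid TYPE('m)" and gcd: "GCD_domain TYPE('r)"
    and "primitive f" "primitive g"
  shows "primitive (f * g)"
  using assms(3,4)
proof (induction "card (Poly_Mapping.keys f) + card (Poly_Mapping.keys g)" arbitrary: f g rule: less_induct)
  case less
  have nz: "h \<noteq> 0" if "primitive h" for h :: "'m \<Rightarrow>\<^sub>0 'r"
    using that unfolding primitive_iff by (metis dvd_0_right dvd_0_left_iff zero_neq_one)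
  obtain r :: "('m \<times> 'm) set" where "invariant_linear_order r"
    using torsion_free_monoid_orderable[OF tf] .
  then obtain s t where s: "s \<in> Poly_Mapping.keys f" and t: "t \<in> Poly_Mapping.keys g"
    and st: "Poly_Mapping.lookup (f * g) (s + t) = Poly_Mapping.lookup f s * Poly_Mapping.lookup g t"
    using leading_coeff_mult[of r f g] nz less.prems by metis
  have step_f: "e dvd 1" if "const e dvd f * g" "e dvd Poly_Mapping.lookup f s" for e
    by (rule common_divisor_with_coeff_unit[OF gcd _ less.prems(1) s that]) (use less in auto)
  have "primitive (h * f)" if "card (Poly_Mapping.keys h) < card (Poly_Mapping.keys g)" "primitive h" for h
    using less.hyps[of f h] less.prems that by (simp add: mult.commute)
  hence step_g: "e dvd 1" if "const e dvd f * g" "e dvd Poly_Mapping.lookup g t" for e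
    using common_divisor_with_coeff_unit[OF gcd _ less.prems(2) t, of f e] that by (simp add: mult.commute)
  show ?case
    unfolding primitive_iff
  proof (intro allI impI)
    fix d assume d: "const d dvd f * g"
    hence "d dvd Poly_Mapping.lookup f s * Poly_Mapping.lookup g t"
      unfolding st[symmetric] by (metis dvd_def lookup_const_mult)
    moreover have "e dvd 1" if "e dvd d" "e dvd Poly_Mapping.lookup f s" for e
    proof (rule step_f[OF _ that(2)])
      have "(const e :: 'm \<Rightarrow>\<^sub>0 'r) dvd const d" using that(1) by (simp add: const_dvd_const_iff)
      thus "const e dvd f * g" using d by (rule dvd_trans)
    qed
    ultimately have "d dvd Poly_Mapping.lookup g t"
      using GCD_domain_coprime_dvd_mult[OF gcd] by blast
    thus "d dvd 1" using step_g d by blast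
  qed
qed

section \<open>Extension of scalars to the field of fractions\<close>

lemma lookup_to_fract_ring: "Poly_Mapping.lookup (to_fract_ring f) k = to_fract (Poly_Mapping.lookup f k)"
  by (simp add: to_fract_ring_def Poly_Mapping.map.rep_eq when_def)

lemma to_fract_ring_0: "to_fract_ring 0 = 0"
  by (rule poly_mapping_eqI) (simp add: lookup_to_fract_ring)

lemma to_fract_ring_eq_iff: "to_fract_ring f = to_fract_ring g \<longleftrightarrow> f = g"
  by (auto simp: poly_mapping_eq_iff lookup_to_fract_ring fun_eq_iff)

lemma to_fract_ring_single: "to_fract_ring (Poly_Mapping.single k c) = Poly_Mapping.single k (to_fract c)"
  by (simp add: to_fract_ring_def)

lemma to_fract_ring_add: "to_fract_ring (f + g) = to_fract_ring f + to_fract_ring g"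
  by (rule poly_mapping_eqI) (simp add: lookup_to_fract_ring lookup_add)

lemma to_fract_ring_sum: "to_fract_ring (\<Sum>i\<in>I. f i) = (\<Sum>i\<in>I. to_fract_ring (f i))"
  by (induction I rule: infinite_finite_induct) (simp_all add: to_fract_ring_0 to_fract_ring_add)

text \<open>
  Bilinearity reduces multiplicativity to monomials.
\<close>

lemma to_fract_ring_mult:
  fixes f g :: "'m::cancel_comm_monoid_add \<Rightarrow>\<^sub>0 'r::idom"
  shows "to_fract_ring (f * g) = to_fract_ring f * to_fract_ring g"
proof -
  have "to_fract_ring ((\<Sum>k\<in>A. Poly_Mapping.single k (a k)) * (\<Sum>k\<in>B. Poly_Mapping.single k (b k)))
      = to_fract_ring (\<Sum>k\<in>A. Poly_Mapping.single k (a k)) * to_fract_ring (\<Sum>k\<in>B. Poly_Mapping.single k (b k))"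
    for A B and a b :: "'m \<Rightarrow> 'r"
    by (simp add: sum_product to_fract_ring_sum mult_single to_fract_ring_single)
  thus ?thesis using poly_mapping_sum_singles[of f] poly_mapping_sum_singles[of g] by metis
qed

lemma to_fract_ring_dvd_one:
  fixes f :: "'m::cancel_comm_monoid_add \<Rightarrow>\<^sub>0 'r::idom"
  assumes "f dvd 1"
  shows "to_fract_ring f dvd 1"
proof -
  obtain g where "1 = f * g" using assms by blast
  hence "to_fract_ring f * to_fract_ring g = to_fract_ring 1"
    by (simp flip: to_fract_ring_mult)
  also have "\<dots> = 1" using to_fract_ring_single[of 0 1] by simp
  finally show ?thesis by (metis dvdI)
qed

lemma to_fract_ring_in_constants_iff: "to_fract_ring f \<in> constants \<longleftrightarrow> f \<in> constants"
  by (auto simp: constants_iff_keys in_keys_iff lookup_to_fract_ring subset_iff)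

lemma clear_denominators:
  fixes G :: "'m::cancel_comm_monoid_add \<Rightarrow>\<^sub>0 'r::idom fract"
  obtains u g where "u \<noteq> 0" "const (to_fract u) * G = to_fract_ring g"
proof -
  have "\<exists>u g. u \<noteq> 0 \<and> const (to_fract u) * (\<Sum>k\<in>K. Poly_Mapping.single k (x k)) = to_fract_ring g"
    if "finite K" for K and x :: "'m \<Rightarrow> 'r fract"
    using that
  proof (induction K)
    case empty
    show ?case using to_fract_ring_0 by (intro exI[of _ 1] exI[of _ 0]) simp
  next
    case (insert k K)
    then obtain u g where u: "u \<noteq> 0"
      and ug: "const (to_fract u) * (\<Sum>k\<in>K. Poly_Mapping.single k (x k)) = to_fract_ring g" by blast
    obtain p q where q: "q \<noteq> 0" and pq: "x k = Fract p q" by (cases "x k") auto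
    have "to_fract q * x k = to_fract p" using q by (simp add: pq Fract_conv_to_fract)
    hence x: "const (to_fract q) * Poly_Mapping.single k (x k) = to_fract_ring (Poly_Mapping.single k p)"
      by (simp add: mult_single to_fract_ring_single)
    have "const (to_fract (u * q)) * (\<Sum>k\<in>insert k K. Poly_Mapping.single k (x k))
        = const (to_fract u) * (const (to_fract q) * Poly_Mapping.single k (x k))
          + const (to_fract q) * (const (to_fract u) * (\<Sum>k\<in>K. Poly_Mapping.single k (x k)))"
      using insert.hyps by (simp add: const_mult algebra_simps)
    also have "\<dots> = to_fract_ring (const u * Poly_Mapping.single k p + const q * g)"
      unfolding x ug by (simp add: to_fract_ring_add to_fract_ring_mult to_fract_ring_single)
    finally show ?case using u q by (intro exI[of _ "u * q"] exI) auto
  qed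
  thus thesis using that poly_mapping_sum_singles[of G] finite_keys[of G] by metis
qed

text \<open>
  Every nonzero element over \<open>F\<close> is a scalar multiple of a primitive element over \<open>R\<close>. The
  scalar appears as a fraction \<open>v / u\<close>, with \<open>u\<close> clearing denominators and \<open>v\<close> the content
  of the cleared element.
\<close>

lemma associated_primitive:
  fixes G :: "'m::cancel_comm_monoid_add \<Rightarrow>\<^sub>0 'r::idom fract"
  assumes "GCD_domain TYPE('r)" "G \<noteq> 0"
  obtains u v g where "u \<noteq> 0" "v \<noteq> 0" "primitive g"
    "const (to_fract u) * G = const (to_fract v) * to_fract_ring g"
proof -
  obtain u h where u: "u \<noteq> 0" "const (to_fract u) * G = to_fract_ring h"
    by (rule clear_denominators)
  have "h \<noteq> 0"
  proof
    assume "h = 0"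
    hence "const (to_fract u) * G = const (to_fract u) * 0" using u(2) by (simp add: to_fract_ring_0)
    thus False using u(1) assms(2) by (subst (asm) const_mult_cancel) auto
  qed
  then obtain v g where "h = const v * g" "v \<noteq> 0" "primitive g"
    using primitive_part[OF assms(1)] by blast
  thus thesis using that u by (simp add: to_fract_ring_mult to_fract_ring_single)
qed

lemma dvd_one_if_associated:
  fixes G H :: "'m::cancel_comm_monoid_add \<Rightarrow>\<^sub>0 'k::field"
  assumes "const x * G = const y * H" "y \<noteq> 0" "H dvd 1"
  shows "G dvd 1"
proof -
  have "(const y :: 'm \<Rightarrow>\<^sub>0 'k) dvd 1" using assms(2) by (simp add: const_dvd_one_iff dvd_field_iff)
  hence "const x * G dvd 1 * 1" unfolding assms(1) using assms(3) by (rule mult_dvd_mono)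
  thus ?thesis by (auto dest: dvd_mult_right)
qed

section \<open>Irreducible elements\<close>

text \<open>
  In the factorisation of \<open>f\<close> into its content and its primitive part, the latter is not constant
  and hence no unit, so the content must be a unit.
\<close>

lemma irreducible_imp_primitive:
  fixes f :: "'m::cancel_comm_monoid_add \<Rightarrow>\<^sub>0 'r::idom"
  assumes M: "reduced_monoid TYPE('m)" "torsion_free_monoid TYPE('m)"
    and gcd: "GCD_domain TYPE('r)" and nonconst: "f \<notin> constants" and irr: "irreducible f"
  shows "primitive f"
proof -
  obtain c g where g: "f = const c * g" "c \<noteq> 0" "primitive g"
    using primitive_part[OF gcd] irr irreducible_def by blast
  have "g \<notin> constants"
    using nonconst g keys_const_mult[of c g] unfolding constants_iff_keys by simp
  hence "\<not> g dvd 1" using unit_in_constants[OF M] by blast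
  hence "const c dvd (1 :: 'm \<Rightarrow>\<^sub>0 'r)" using irreducibleD[OF irr g(1)] by blast
  hence "c dvd 1" by (simp add: const_dvd_one_iff)
  thus ?thesis
    unfolding primitive_iff g(1)
    using primitive_const_dvd_const_mult[OF gcd g(3)] by (blast intro: dvd_trans)
qed

text \<open>
  A factorisation over \<open>F\<close> is, up to scalars, one into primitive elements \<open>g\<close> and \<open>h\<close> over
  \<open>R\<close>. The scalar between \<open>f\<close> and \<open>g h\<close> lies in \<open>R\<close> by the lemma of Gauss, so one of
  \<open>g\<close> and \<open>h\<close> is a unit.
\<close>

lemma irreducible_imp_irreducible_to_fract_ring:
  fixes f :: "'m::cancel_comm_monoid_add \<Rightarrow>\<^sub>0 'r::idom"
  assumes M: "reduced_monoid TYPE('m)" "torsion_free_monoid TYPE('m)"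
    and gcd: "GCD_domain TYPE('r)" and nonconst: "f \<notin> constants" and irr: "irreducible f"
  shows "irreducible (to_fract_ring f)"
proof (rule irreducibleI)
  show nz: "to_fract_ring f \<noteq> 0"
    using irr to_fract_ring_eq_iff[of f 0] by (auto simp: to_fract_ring_0 irreducible_def)
  show "\<not> to_fract_ring f dvd 1"
    using unit_in_constants[OF M] nonconst to_fract_ring_in_constants_iff by blast
  fix G H assume GH: "to_fract_ring f = G * H"
  have "G \<noteq> 0" "H \<noteq> 0" using nz GH by auto
  obtain u v g where g: "u \<noteq> 0" "v \<noteq> 0" "primitive g"
    "const (to_fract u) * G = const (to_fract v) * to_fract_ring g"
    using associated_primitive[OF gcd \<open>G \<noteq> 0\<close>] by blast
  obtain u' v' h where h: "u' \<noteq> 0" "v' \<noteq> 0" "primitive h"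
    "const (to_fract u') * H = const (to_fract v') * to_fract_ring h"
    using associated_primitive[OF gcd \<open>H \<noteq> 0\<close>] by blast
  have "to_fract_ring (const (u * u') * f) = (const (to_fract u) * G) * (const (to_fract u') * H)"
    by (simp add: GH to_fract_ring_mult to_fract_ring_single const_mult mult_ac)
  also have "\<dots> = to_fract_ring (const (v * v') * (g * h))"
    unfolding g(4) h(4) by (simp add: to_fract_ring_mult to_fract_ring_single const_mult mult_ac)
  finally have eq: "const (u * u') * f = const (v * v') * (g * h)"
    by (simp only: to_fract_ring_eq_iff)
  have "primitive (g * h)" by (rule gauss_lemma[OF M(2) gcd g(3) h(3)])
  hence "u * u' dvd v * v'"
    by (rule primitive_const_dvd_const_mult[OF gcd]) (simp flip: eq)
  then obtain e where "v * v' = u * u' * e" by blast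
  hence "const (u * u') * f = const (u * u') * ((const e * g) * h)"
    using eq by (simp add: const_mult mult.assoc)
  moreover have "u * u' \<noteq> 0" using g(1) h(1) by simp
  ultimately have "f = (const e * g) * h" by (metis const_mult_cancel)
  hence "g dvd 1 \<or> h dvd 1" using irreducibleD[OF irr] dvd_mult_right by blast
  thus "G dvd 1 \<or> H dvd 1"
  proof
    assume "g dvd 1"
    thus ?thesis using dvd_one_if_associated[OF g(4)] g(2) by (simp add: to_fract_ring_dvd_one)
  next
    assume "h dvd 1"
    thus ?thesis using dvd_one_if_associated[OF h(4)] h(2) by (simp add: to_fract_ring_dvd_one)
  qed
qed

text \<open>
  A factor of \<open>f\<close> that becomes a unit over \<open>F\<close> is a constant, and a constant dividing a
  primitive element is a unit.
\<close>

lemma irreducible_if_irreducible_to_fract_ring: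
  fixes f :: "'m::cancel_comm_monoid_add \<Rightarrow>\<^sub>0 'r::idom"
  assumes M: "reduced_monoid TYPE('m)" "torsion_free_monoid TYPE('m)"
    and irr: "irreducible (to_fract_ring f)" and prim: "primitive f"
  shows "irreducible f"
proof (rule irreducibleI)
  show "f \<noteq> 0" using irr by (auto simp: to_fract_ring_0)
  show "\<not> f dvd 1" using irr to_fract_ring_dvd_one by (auto simp: irreducible_def)
  have unit: "g dvd 1" if g: "g dvd f" "to_fract_ring g dvd 1" for g
  proof -
    have "g \<in> constants"
      using unit_in_constants[OF M g(2)] by (simp add: to_fract_ring_in_constants_iff)
    then obtain c where c: "g = const c" unfolding constants_def by blast
    thus ?thesis using prim g(1) unfolding primitive_iff by (simp add: const_dvd_one_iff)
  qed
  fix g h assume "f = g * h"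
  thus "g dvd 1 \<or> h dvd 1"
    using unit[of g] unit[of h] irreducibleD[OF irr] by (auto simp: to_fract_ring_mult)
qed

theorem theorem3p3:
  fixes f :: "'m::cancel_comm_monoid_add \<Rightarrow>\<^sub>0 'r::idom"
  assumes "reduced_monoid TYPE('m)" and "torsion_free_monoid TYPE('m)"
    and "GCD_domain TYPE('r)"
    and "f \<notin> constants"
  shows "irreducible f \<longleftrightarrow> irreducible (to_fract_ring f) \<and> primitive f"
proof
  assume "irreducible f"
  thus "irreducible (to_fract_ring f) \<and> primitive f"
    using irreducible_imp_irreducible_to_fract_ring[OF assms] irreducible_imp_primitive[OF assms] by simp
next
  assume "irreducible (to_fract_ring f) \<and> primitive f"
  thus "irreducible f"
    using irreducible_if_irreducible_to_fract_ring[OF assms(1,2), of f] by blast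
qed

end
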